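(* Let $Z$ be a nonmeagre subset of $\mathbb{R}$ with the property of Baire and let $k\in\mathbb{N}$ with $k\geq 2$. Then there is an uncountable subset $H$ of $\mathbb{R}$ such that $kH\subseteq Z$.
   Context: $kH=H+H+\cdots+H$ ($k$ times) $=\{h_1+\cdots+h_k:h_i\in H\}$, repetitions allowed. *)

theory Defs
  imports "HOL-Analysis.Analysis"
begin

definition nowhere_dense :: "'a::topological_space set \<Rightarrow> bool"
  where "nowhere_dense N \<longleftrightarrow> interior (closure N) = {}"

definition meagre :: "'a::topological_space set \<Rightarrow> bool"
  where "meagre S \<longleftrightarrow> (\<exists>\<N>. countable \<N> \<and> (\<forall>N\<in>\<N>. nowhere_dense N) \<and> S = \<Union>\<N>)"

definition baire_property :: "'a::topological_space set \<Rightarrow> bool"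
  where "baire_property Z \<longleftrightarrow> (\<exists>U. open U \<and> meagre ((Z - U) \<union> (U - Z)))"

(* Not the dilate {k * h | h. h \<in> H}: the summands h i vary independently,
   with repetitions allowed. *)
definition kfold_sumset :: "nat \<Rightarrow> 'a::comm_monoid_add set \<Rightarrow> 'a set"
  where "kfold_sumset k H = {(\<Sum>i<k. h i) | h. \<forall>i<k. h i \<in> H}"

end

theory Submission
  imports Defs
begin

text \<open>
  \<open>Z\<close> contains, up to a meagre set \<open>M\<close>, a ball \<open>U = B(c, e)\<close>. By Zorn's lemma choose \<open>H\<close> maximal
  among the subsets of \<open>U / k = B(c / k, e / k)\<close> with \<open>k H \<subseteq> Z\<close>. If \<open>H\<close> were countable, then the
  affine preimages \<open>{x. j x + s \<in> M}\<close>, with \<open>1 \<le> j \<le> k\<close> and \<open>s\<close> a finite sum of elements of \<open>H\<close>,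
  would be countably many meagre sets, so by the Baire category theorem some \<open>x \<in> U / k - H\<close> avoids
  all of them, and \<open>H \<union> {x}\<close> contradicts maximality.
\<close>

lemma nowhere_dense_subset: "nowhere_dense N \<Longrightarrow> S \<subseteq> N \<Longrightarrow> nowhere_dense S"
  unfolding nowhere_dense_def by (metis closure_mono interior_mono subset_empty)

text \<open>For \<open>c \<noteq> 0\<close> the map is continuous and open. An open subset of the
  closure of the preimage would therefore have an open image inside
  \<open>closure N\<close>.\<close>

lemma nowhere_dense_affine_vimage:
  fixes N :: "'a::real_normed_vector set"
  assumes "nowhere_dense N" "c \<noteq> 0"
  shows "nowhere_dense ((\<lambda>x. a + c *\<^sub>R x) -` N)"
proof -
  let ?f = "\<lambda>x::'a. a + c *\<^sub>R x"
  let ?W = "interior (closure (?f -` N))"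
  have "closed (?f -` closure N)"
    by (intro closed_vimage continuous_intros) auto
  then have "closure (?f -` N) \<subseteq> ?f -` closure N"
    by (intro closure_minimal vimage_mono closure_subset)
  then have "?f ` ?W \<subseteq> closure N"
    using interior_subset by fast
  moreover have "open (?f ` ?W)"
    using open_affinity[OF open_interior \<open>c \<noteq> 0\<close>] .
  ultimately have "?f ` ?W \<subseteq> interior (closure N)"
    by (rule interior_maximal)
  then show ?thesis
    using assms(1) by (auto simp: nowhere_dense_def)
qed

lemma meagre_subset:
  assumes "meagre T" "S \<subseteq> T"
  shows "meagre S"
proof -
  obtain \<N> where N: "countable \<N>" "\<forall>N\<in>\<N>. nowhere_dense N" "T = \<Union>\<N>"
    using assms(1) unfolding meagre_def by blast
  \<comment> \<open>\<open>meagre\<close> asks for a union equal to the set, not merely covering it,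
    so each piece is cut down to \<open>S\<close>.\<close>
  have "S = \<Union>((\<lambda>N. S \<inter> N) ` \<N>)"
    using N(3) assms(2) by auto
  moreover have "\<forall>N\<in>(\<lambda>N. S \<inter> N) ` \<N>. nowhere_dense N"
    using N(2) nowhere_dense_subset by blast
  ultimately show ?thesis
    using N(1) unfolding meagre_def by blast
qed

lemma meagre_UN:
  assumes "countable I" "\<And>i. i \<in> I \<Longrightarrow> meagre (A i)"
  shows "meagre (\<Union>i\<in>I. A i)"
proof -
  obtain \<N> where N: "\<And>i. i \<in> I \<Longrightarrow>
      countable (\<N> i) \<and> (\<forall>N\<in>\<N> i. nowhere_dense N) \<and> A i = \<Union>(\<N> i)"
    using assms(2) unfolding meagre_def by metis
  have "countable (\<Union>i\<in>I. \<N> i)"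
    using N assms(1) by (intro countable_UN) auto
  moreover have "\<forall>N\<in>(\<Union>i\<in>I. \<N> i). nowhere_dense N"
    using N by auto
  moreover have "(\<Union>i\<in>I. A i) = \<Union>(\<Union>i\<in>I. \<N> i)"
    using N by auto
  ultimately show ?thesis
    unfolding meagre_def by blast
qed

lemma meagre_Un: "meagre S \<Longrightarrow> meagre T \<Longrightarrow> meagre (S \<union> T)"
  using meagre_UN[of "{S, T}" id] by auto

lemma meagre_affine_vimage:
  fixes S :: "'a::real_normed_vector set"
  assumes "meagre S" "c \<noteq> 0"
  shows "meagre ((\<lambda>x. a + c *\<^sub>R x) -` S)"
proof -
  obtain \<N> where N: "countable \<N>" "\<forall>N\<in>\<N>. nowhere_dense N" "S = \<Union>\<N>"
    using assms(1) unfolding meagre_def by blast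
  have "(\<lambda>x. a + c *\<^sub>R x) -` S = \<Union>((\<lambda>N. (\<lambda>x. a + c *\<^sub>R x) -` N) ` \<N>)"
    using N(3) by auto
  moreover have "\<forall>N\<in>(\<lambda>N. (\<lambda>x. a + c *\<^sub>R x) -` N) ` \<N>. nowhere_dense N"
    using N(2) nowhere_dense_affine_vimage[OF _ assms(2)] by blast
  ultimately show ?thesis
    using N(1) unfolding meagre_def by blast
qed

lemma countable_imp_meagre:
  fixes S :: "'a::{t1_space, perfect_space} set"
  assumes "countable S"
  shows "meagre S"
proof -
  have "nowhere_dense {x}" for x :: 'a
    by (simp add: nowhere_dense_def)
  moreover have "S = \<Union>((\<lambda>x. {x}) ` S)"
    by auto
  ultimately show ?thesis
    using assms unfolding meagre_def
    by (intro exI[of _ "(\<lambda>x. {x}) ` S"]) auto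
qed

text \<open>By Baire, the complements of the closures, being countably many dense open sets, have a
  dense intersection; but this intersection would miss all of \<open>U\<close>.\<close>

lemma open_not_meagre:
  fixes U :: "'a::{real_normed_vector, heine_borel} set"
  assumes "open U" "U \<noteq> {}"
  shows "\<not> meagre U"
proof
  assume "meagre U"
  then obtain \<N> where N: "countable \<N>" "\<forall>N\<in>\<N>. nowhere_dense N" "U = \<Union>\<N>"
    unfolding meagre_def by blast
  let ?G = "(\<lambda>N. - closure N) ` \<N>"
  have "UNIV \<subseteq> closure (\<Inter>?G)"
  proof (rule Baire)
    show "openin (top_of_set UNIV) T \<and> UNIV \<subseteq> closure T" if "T \<in> ?G" for T
      using that N(2) by (auto simp: nowhere_dense_def closure_complement)
  qed (use N(1) in auto)
  moreover have "x \<notin> \<Inter>?G" if "x \<in> U" for x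
    using that N(3) closure_subset[of "_ :: 'a set"] by blast
  then have "U \<inter> \<Inter>?G = {}"
    by blast
  ultimately show False
    using assms open_Int_closure_eq_empty[of U "\<Inter>?G"] by auto
qed

text \<open>Collect the indices with \<open>h i = x\<close>: \<open>j\<close> is their number and
  \<open>s\<close> the sum of the other terms. Taking \<open>s\<close> from sums of lists over
  \<open>H\<close> allows repetitions and leaves only countably many values when \<open>H\<close> is
  countable.\<close>

lemma sum_insert_decompose:
  fixes h :: "nat \<Rightarrow> real"
  assumes "\<forall>i<k. h i \<in> insert x H" "\<not> (\<forall>i<k. h i \<in> H)"
  shows "\<exists>j\<in>{1..k}. \<exists>s\<in>sum_list ` lists H. (\<Sum>i<k. h i) = s + real j * x"
proof -
  let ?J = "{i. i < k \<and> h i = x}"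
  let ?xs = "map h (filter (\<lambda>i. h i \<noteq> x) [0..<k])"
  have "{..<k} = {i. i < k \<and> h i \<noteq> x} \<union> ?J"
    by auto
  then have "(\<Sum>i<k. h i) = (\<Sum>i | i < k \<and> h i \<noteq> x. h i) + (\<Sum>i\<in>?J. h i)"
    by (simp add: sum.union_disjoint disjoint_iff)
  moreover have "(\<Sum>i | i < k \<and> h i \<noteq> x. h i) = sum_list ?xs"
    by (subst sum_list_distinct_conv_sum_set) (auto intro: sum.cong)
  moreover have "(\<Sum>i\<in>?J. h i) = real (card ?J) * x"
    by simp
  moreover have "?xs \<in> lists H"
    using assms(1) by auto
  \<comment> \<open>Some \<open>h i\<close> lies outside \<open>H\<close>, so it equals
    \<open>x\<close>. Hence \<open>j \<ge> 1\<close>, and the affine map with slope \<open>j\<close>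
    is invertible.\<close>
  moreover have "?J \<noteq> {}"
    using assms by blast
  then have "1 \<le> card ?J"
    by (simp add: Suc_le_eq card_gt_0_iff)
  moreover have "card ?J \<le> k"
    using card_mono[of "{..<k}" ?J] by auto
  ultimately show ?thesis
    by (intro bexI[of _ "card ?J"] bexI[of _ "sum_list ?xs"]) auto
qed

text \<open>Triangle inequality: \<open>k\<close> errors, each below \<open>e / k\<close>, add up to
  less than \<open>e\<close>. This keeps the sums where \<open>Z\<close> is comeagre.\<close>

lemma sum_in_ball:
  fixes h :: "nat \<Rightarrow> real"
  assumes "k > 0" "\<forall>i<k. h i \<in> ball (c / real k) (e / real k)"
  shows "(\<Sum>i<k. h i) \<in> ball c e"
proof -
  have "norm (\<Sum>i<k. h i - c / k) < e"
  proof -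
    have "norm (\<Sum>i<k. h i - c / k) \<le> (\<Sum>i<k. norm (h i - c / k))"
      by (rule norm_sum)
    also have "\<dots> < (\<Sum>i<k. e / k)"
      using assms by (intro sum_strict_mono) (auto simp: dist_norm norm_minus_commute)
    finally show ?thesis
      using assms(1) by simp
  qed
  moreover have "(\<Sum>i<k. h i - c / k) = (\<Sum>i<k. h i) - c"
    using assms(1) by (simp add: sum_subtractf)
  ultimately show ?thesis
    by (simp add: dist_norm norm_minus_commute)
qed

text \<open>A sum involves only finitely many elements of the union, and these already lie in one
  member of the chain. This supplies the upper bounds for Zorn's lemma.\<close>

lemma kfold_sumset_Union_chain:
  assumes "\<And>S T. S \<in> \<C> \<Longrightarrow> T \<in> \<C> \<Longrightarrow> S \<subseteq> T \<or> T \<subseteq> S" "\<C> \<noteq> {}"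
    and "\<And>S. S \<in> \<C> \<Longrightarrow> kfold_sumset k S \<subseteq> Z"
  shows "kfold_sumset k (\<Union>\<C>) \<subseteq> Z"
proof
  fix y assume "y \<in> kfold_sumset k (\<Union>\<C>)"
  then obtain h where y: "y = (\<Sum>i<k. h i)" and "\<forall>i<k. h i \<in> \<Union>\<C>"
    unfolding kfold_sumset_def by blast
  then have h: "h ` {..<k} \<subseteq> \<Union>\<C>"
    by blast
  have "subset.chain UNIV \<C>"
    using assms(1) by (simp add: subset_chain_def)
  then obtain S where S: "S \<in> \<C>" "h ` {..<k} \<subseteq> S"
    using finite_subset_Union_chain[OF _ h assms(2)] by blast
  then have "y \<in> kfold_sumset k S"
    using y unfolding kfold_sumset_def by auto
  then show "y \<in> Z"
    using assms(3) S(1) by blast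
qed

lemma kfold_sumset_extend:
  fixes Z H :: "real set"
  assumes "e > 0" "k > 0" and M: "meagre (ball c e - Z)"
    and "countable H" and HI: "H \<subseteq> ball (c / real k) (e / real k)"
    and HZ: "kfold_sumset k H \<subseteq> Z"
  shows "\<exists>x\<in>ball (c / real k) (e / real k) - H. kfold_sumset k (insert x H) \<subseteq> Z"
proof -
  let ?I = "ball (c / real k) (e / real k)"
  let ?P = "{1..k} \<times> sum_list ` lists H"
  \<comment> \<open>The bad choices of \<open>x\<close>: those for which \<open>s + j x\<close>
    falls into the part of the ball missed by \<open>Z\<close>.\<close>
  let ?B = "\<lambda>(j, s). (\<lambda>x. s + real j *\<^sub>R x) -` (ball c e - Z)"
  have "meagre (\<Union>p\<in>?P. ?B p)"
  proof (rule meagre_UN)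
    show "countable ?P"
      using \<open>countable H\<close> by (intro countable_SIGMA countable_image countable_lists) auto
    show "meagre (?B p)" if "p \<in> ?P" for p
      using that meagre_affine_vimage[OF M] by auto
  qed
  \<comment> \<open>Adding \<open>H\<close> to the excluded set makes the point found below a new
    one.\<close>
  then have "meagre ((\<Union>p\<in>?P. ?B p) \<union> H)"
    using \<open>countable H\<close> by (rule meagre_Un[OF _ countable_imp_meagre])
  moreover have "\<not> meagre ?I"
    using assms(1,2) by (intro open_not_meagre) (auto simp: not_le)
  ultimately have "\<not> ?I \<subseteq> (\<Union>p\<in>?P. ?B p) \<union> H"
    by (metis meagre_subset)
  then obtain x where x: "x \<in> ?I" "x \<notin> H" and xB: "x \<notin> (\<Union>p\<in>?P. ?B p)"
    by (meson UnCI subsetI)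
  have "kfold_sumset k (insert x H) \<subseteq> Z"
  proof
    fix y assume "y \<in> kfold_sumset k (insert x H)"
    then obtain h where y: "y = (\<Sum>i<k. h i)" and h: "\<forall>i<k. h i \<in> insert x H"
      unfolding kfold_sumset_def by auto
    show "y \<in> Z"
    proof (cases "\<forall>i<k. h i \<in> H")
      case True
      then show ?thesis
        using HZ y unfolding kfold_sumset_def by blast
    next
      case False
      then obtain j s where js: "j \<in> {1..k}" "s \<in> sum_list ` lists H" "y = s + real j * x"
        using sum_insert_decompose[OF h] y by blast
      have "x \<notin> ?B (j, s)"
        using xB js(1,2) by blast
      \<comment> \<open>Avoiding \<open>?B (j, s)\<close> only says that \<open>y\<close> is not in
        \<open>ball c e - Z\<close>; membership in the ball is what turns this into
        \<open>y \<in> Z\<close>.\<close>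
      moreover have "y \<in> ball c e"
        unfolding y using \<open>k > 0\<close> h HI x(1) by (intro sum_in_ball) auto
      ultimately show ?thesis
        using js(3) by auto
    qed
  qed
  then show ?thesis
    using x by blast
qed

theorem theorem4p2:
  fixes Z :: "real set" and k :: nat
  assumes "\<not> meagre Z"
    and "baire_property Z"
    and "k \<ge> 2"
  shows "\<exists>H :: real set. uncountable H \<and> kfold_sumset k H \<subseteq> Z"
proof -
  obtain U where U: "open U" "meagre ((Z - U) \<union> (U - Z))"
    using assms(2) unfolding baire_property_def by blast
  \<comment> \<open>For empty \<open>U\<close> the symmetric difference would be \<open>Z\<close>
    itself, which is not meagre.\<close>
  have "U \<noteq> {}"
    using U(2) assms(1) by auto
  then obtain c e where e: "e > 0" "ball c e \<subseteq> U"
    using U(1) by (meson ex_in_conv open_contains_ball)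
  have M: "meagre (ball c e - Z)"
    using U(2) by (rule meagre_subset) (use e(2) in auto)
  define \<A> where
    "\<A> = {H. H \<subseteq> ball (c / real k) (e / real k) \<and> kfold_sumset k H \<subseteq> Z}"
  \<comment> \<open>As \<open>k > 0\<close>, the sumset of \<open>{}\<close> is empty; for
    \<open>k = 0\<close> the empty sum would make it \<open>{0}\<close>.\<close>
  have "{} \<in> \<A>"
    using assms(3) by (auto simp: \<A>_def kfold_sumset_def dest!: spec[of _ 0])
  moreover have "\<Union>\<C> \<in> \<A>" if "\<C> \<noteq> {}" "subset.chain \<A> \<C>" for \<C>
  proof -
    have "\<C> \<subseteq> \<A>" and chain: "\<And>S T. S \<in> \<C> \<Longrightarrow> T \<in> \<C> \<Longrightarrow> S \<subseteq> T \<or> T \<subseteq> S"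
      using \<open>subset.chain \<A> \<C>\<close> unfolding subset_chain_def by blast+
    then have "S \<subseteq> ball (c / real k) (e / real k)" "kfold_sumset k S \<subseteq> Z" if "S \<in> \<C>" for S
      using that unfolding \<A>_def by blast+
    then show ?thesis
      using kfold_sumset_Union_chain[of \<C> k Z] chain \<open>\<C> \<noteq> {}\<close> unfolding \<A>_def by blast
  qed
  ultimately obtain H where H: "H \<in> \<A>" "\<And>X. X \<in> \<A> \<Longrightarrow> H \<subseteq> X \<Longrightarrow> X = H"
    using subset_Zorn_nonempty[of \<A>] by blast
  have "uncountable H"
  proof
    assume "countable H"
    moreover have "k > 0"
      using assms(3) by simp
    ultimately obtain x where "x \<in> ball (c / real k) (e / real k) - H" "kfold_sumset k (insert x H) \<subseteq> Z"
      using kfold_sumset_extend[OF e(1) _ M, of k H] H(1) unfolding \<A>_def by blast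
    then have "insert x H \<in> \<A>" "x \<notin> H"
      using H(1) by (auto simp: \<A>_def)
    then show False
      using H(2) by blast
  qed
  then show ?thesis
    using H(1) by (auto simp: \<A>_def)
qed

end
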